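(* Let $Q$ be a commutative RIF loop. Then $Q/Z(Q)$ has exponent $6$.
   Context: A loop is a set $Q$ with a binary operation with neutral element $1$ such that for all $a,b\in Q$ the equations $ax=b$ and $ya=b$ have unique solutions $x,y\in Q$. A loop is an inverse property (IP) loop if each $x$ has a (two-sided) inverse $x^{-1}$ with $x^{-1}(xy)=y$ and $(yx)x^{-1}=y$ for all $y$. A RIF loop is an IP loop satisfying either, and hence both, of the (equivalent) identities $((xy)z)(xy)=x(y((zx)y))$ and $(xy)(z(xy))=((x(yz))x)y$. It is known that RIF loops are diassociative, i.e., any two elements generate a subgroup; so powers are well defined. The center $Z(Q)$ is the set of all $a\in Q$ such that for all $x,y\in Q$: $ax=xa$, $a(xy)=(ax)y$, $x(ay)=(xa)y$, and $x(ya)=(xy)a$; it is a normal subloop of $Q$. A loop has exponent $n$ if $x^n=1$ for all its elements $x$. *)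

theory Defs
  imports "HOL-Algebra.Coset"
begin

text \<open>Loops are carried by the record of HOL-Algebra's monoids, whose operation is
  not required to be associative by itself. This makes the library's cosets,
  \<open>Q Mod H\<close> and the powers \<open>x [^] n\<close> available for loops.\<close>

locale loop =
  fixes Q (structure)
  assumes m_closed: "\<lbrakk>a \<in> carrier Q; b \<in> carrier Q\<rbrakk> \<Longrightarrow> a \<otimes> b \<in> carrier Q"
    and one_closed: "\<one> \<in> carrier Q"
    and l_one: "a \<in> carrier Q \<Longrightarrow> \<one> \<otimes> a = a"
    and r_one: "a \<in> carrier Q \<Longrightarrow> a \<otimes> \<one> = a"
    and l_div: "\<lbrakk>a \<in> carrier Q; b \<in> carrier Q\<rbrakk> \<Longrightarrow> \<exists>!x. x \<in> carrier Q \<and> a \<otimes> x = b"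
    and r_div: "\<lbrakk>a \<in> carrier Q; b \<in> carrier Q\<rbrakk> \<Longrightarrow> \<exists>!y. y \<in> carrier Q \<and> y \<otimes> a = b"

locale ip_loop = loop +
  assumes inverse_property:
    "x \<in> carrier Q \<Longrightarrow> \<exists>x' \<in> carrier Q. x \<otimes> x' = \<one> \<and> x' \<otimes> x = \<one> \<and>
       (\<forall>y \<in> carrier Q. x' \<otimes> (x \<otimes> y) = y \<and> (y \<otimes> x) \<otimes> x' = y)"

text \<open>In an IP loop the two identities are equivalent (each is obtained from the
  other by taking inverses), so either one may be the defining one.\<close>

locale rif_loop = ip_loop +
  assumes rif:
    "(\<forall>x \<in> carrier Q. \<forall>y \<in> carrier Q. \<forall>z \<in> carrier Q.
        ((x \<otimes> y) \<otimes> z) \<otimes> (x \<otimes> y) = x \<otimes> (y \<otimes> ((z \<otimes> x) \<otimes> y))) \<or>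
     (\<forall>x \<in> carrier Q. \<forall>y \<in> carrier Q. \<forall>z \<in> carrier Q.
        (x \<otimes> y) \<otimes> (z \<otimes> (x \<otimes> y)) = ((x \<otimes> (y \<otimes> z)) \<otimes> x) \<otimes> y)"

locale comm_rif_loop = rif_loop +
  assumes m_comm: "\<lbrakk>x \<in> carrier Q; y \<in> carrier Q\<rbrakk> \<Longrightarrow> x \<otimes> y = y \<otimes> x"

definition loop_center :: "('a, 'b) monoid_scheme \<Rightarrow> 'a set" where
  "loop_center Q = {a \<in> carrier Q. \<forall>x \<in> carrier Q. \<forall>y \<in> carrier Q.
     a \<otimes>\<^bsub>Q\<^esub> x = x \<otimes>\<^bsub>Q\<^esub> a \<and>
     a \<otimes>\<^bsub>Q\<^esub> (x \<otimes>\<^bsub>Q\<^esub> y) = (a \<otimes>\<^bsub>Q\<^esub> x) \<otimes>\<^bsub>Q\<^esub> y \<and>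
     x \<otimes>\<^bsub>Q\<^esub> (a \<otimes>\<^bsub>Q\<^esub> y) = (x \<otimes>\<^bsub>Q\<^esub> a) \<otimes>\<^bsub>Q\<^esub> y \<and>
     x \<otimes>\<^bsub>Q\<^esub> (y \<otimes>\<^bsub>Q\<^esub> a) = (x \<otimes>\<^bsub>Q\<^esub> y) \<otimes>\<^bsub>Q\<^esub> a}"

text \<open>For \<open>Z = loop_center Q\<close>, left and right cosets agree and the setwise product used
  by \<open>Q Mod Z\<close> satisfies \<open>(Z #> a) <#> (Z #> b) = Z #> (a \<otimes> b)\<close>, so \<open>Q Mod Z\<close> is the
  quotient loop even though the library defines it with groups in mind.\<close>

text \<open>\<open>n\<close> need not be the least such number. The library's power is
  left-nested, \<open>x [^] Suc n = x [^] n \<otimes> x\<close>; in diassociative loops the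
  bracketing is irrelevant.\<close>

definition has_exponent :: "('a, 'b) monoid_scheme \<Rightarrow> nat \<Rightarrow> bool" where
  "has_exponent Q n \<longleftrightarrow> (\<forall>x \<in> carrier Q. x [^]\<^bsub>Q\<^esub> n = \<one>\<^bsub>Q\<^esub>)"

end

theory Submission
  imports Defs
begin

text \<open>Write \<open>L x\<close> for the translation by \<open>x\<close>. For commutative loops the RIF identity says
  \<open>(L (x y))\<^sup>2 = L x (L y)\<^sup>2 L x\<close>, and \<open>L (x\<^sup>2) = (L x)\<^sup>2\<close>. Since the left-hand side is symmetric
  in \<open>x\<close> and \<open>y\<close>, one obtains \<open>L (w v\<^sup>2) = (L w)\<^sup>-\<^sup>1 L (v\<^sup>2) (L w)\<^sup>2\<close>, hence the ARIF identity
  \<open>L (x y\<^sup>2) L x = L y L (x\<^sup>2 y)\<close>. With \<open>y = a\<close> a square, \<open>L (x\<^sup>2 a) = L x L a L x\<close> by RIF,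
  so \<open>L (a\<^sup>2 x) = L a L x L a\<close>: every square \<open>a\<close> is a Moufang element.
  As in commutative Moufang loops, the cube of a Moufang element is central; thus every \<open>x\<^sup>6\<close> is central.\<close>

section \<open>Inverses in IP loops\<close>

context ip_loop
begin

lemma
  assumes x: "x \<in> carrier Q"
  shows inv_closed: "inv x \<in> carrier Q"
    and inv_cancel_left: "y \<in> carrier Q \<Longrightarrow> inv x \<otimes> (x \<otimes> y) = y"
    and inv_cancel_right: "y \<in> carrier Q \<Longrightarrow> (y \<otimes> x) \<otimes> inv x = y"
    and l_inv: "inv x \<otimes> x = \<one>"
    and r_inv: "x \<otimes> inv x = \<one>"
proof -
  obtain x' where x': "x' \<in> carrier Q" "x \<otimes> x' = \<one>" "x' \<otimes> x = \<one>"
    "\<And>y. y \<in> carrier Q \<Longrightarrow> x' \<otimes> (x \<otimes> y) = y" "\<And>y. y \<in> carrier Q \<Longrightarrow> (y \<otimes> x) \<otimes> x' = y"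
    using inverse_property[OF x] by blast
  \<comment> \<open>\<open>inv\<close> is a definite description of a two-sided inverse; unique
    solvability of \<open>x \<otimes> y = \<one>\<close> identifies it with
    \<open>x'\<close>.\<close>
  have "inv x = x'"
    unfolding m_inv_def using x' l_div[OF x one_closed] by (intro the_equality) auto
  with x' show "inv x \<in> carrier Q"
    and "y \<in> carrier Q \<Longrightarrow> inv x \<otimes> (x \<otimes> y) = y"
    and "y \<in> carrier Q \<Longrightarrow> (y \<otimes> x) \<otimes> inv x = y"
    and "inv x \<otimes> x = \<one>" "x \<otimes> inv x = \<one>"
    by auto
qed

lemma inv_inv: "x \<in> carrier Q \<Longrightarrow> inv (inv x) = x"
  by (metis inv_cancel_left inv_closed l_inv r_one)

lemma cancel_inv_left: "\<lbrakk>x \<in> carrier Q; y \<in> carrier Q\<rbrakk> \<Longrightarrow> x \<otimes> (inv x \<otimes> y) = y"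
  by (metis inv_cancel_left inv_closed inv_inv)

lemma inv_mult:
  assumes "x \<in> carrier Q" "y \<in> carrier Q"
  shows "inv (x \<otimes> y) = inv y \<otimes> inv x"
proof -
  have "inv (x \<otimes> y) \<otimes> x = inv y"
    using assms by (metis inv_cancel_left inv_cancel_right inv_closed m_closed)
  then show ?thesis
    using assms by (metis inv_cancel_right inv_closed m_closed)
qed

end

section \<open>Translation identities in commutative RIF loops\<close>

context comm_rif_loop
begin

text \<open>Commutativity brings either alternative of \<open>rif\<close> into this one form, so
  later arguments need no case split.\<close>

lemma comm_rif:
  assumes "x \<in> carrier Q" "y \<in> carrier Q" "z \<in> carrier Q"
  shows "(x \<otimes> y) \<otimes> ((x \<otimes> y) \<otimes> z) = x \<otimes> (y \<otimes> (y \<otimes> (x \<otimes> z)))"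
  using rif
proof
  assume "\<forall>x\<in>carrier Q. \<forall>y\<in>carrier Q. \<forall>z\<in>carrier Q.
    ((x \<otimes> y) \<otimes> z) \<otimes> (x \<otimes> y) = x \<otimes> (y \<otimes> ((z \<otimes> x) \<otimes> y))"
  then have "((x \<otimes> y) \<otimes> z) \<otimes> (x \<otimes> y) = x \<otimes> (y \<otimes> ((z \<otimes> x) \<otimes> y))"
    using assms by blast
  then show ?thesis
    using assms by (simp add: m_comm m_closed)
next
  assume "\<forall>x\<in>carrier Q. \<forall>y\<in>carrier Q. \<forall>z\<in>carrier Q.
    (x \<otimes> y) \<otimes> (z \<otimes> (x \<otimes> y)) = ((x \<otimes> (y \<otimes> z)) \<otimes> x) \<otimes> y"
  \<comment> \<open>\<open>x\<close> and \<open>y\<close> are exchanged because this alternative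
    expands with the second factor outermost.\<close>
  then have "(y \<otimes> x) \<otimes> (z \<otimes> (y \<otimes> x)) = ((y \<otimes> (x \<otimes> z)) \<otimes> y) \<otimes> x"
    using assms by blast
  then show ?thesis
    using assms by (simp add: m_comm m_closed)
qed

text \<open>RIF evaluated at \<open>inv y\<close>, where the innermost product on the right
  collapses to \<open>\<one>\<close>.\<close>

lemma left_alternative:
  assumes x: "x \<in> carrier Q" and y: "y \<in> carrier Q"
  shows "x \<otimes> (x \<otimes> y) = (x \<otimes> x) \<otimes> y"
proof -
  have "(y \<otimes> x) \<otimes> x = (y \<otimes> x) \<otimes> ((y \<otimes> x) \<otimes> inv y)"
    using x y by (metis m_comm inv_cancel_right)
  also have "\<dots> = y \<otimes> (x \<otimes> (x \<otimes> (y \<otimes> inv y)))"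
    using x y by (simp add: comm_rif inv_closed)
  also have "\<dots> = y \<otimes> (x \<otimes> x)"
    using x y by (simp add: r_inv r_one)
  finally show ?thesis
    using x y by (metis m_closed m_comm)
qed

lemma rif_square:
  assumes "x \<in> carrier Q" "y \<in> carrier Q" "z \<in> carrier Q"
  shows "((x \<otimes> y) \<otimes> (x \<otimes> y)) \<otimes> z = x \<otimes> ((y \<otimes> y) \<otimes> (x \<otimes> z))"
  using comm_rif[OF assms] assms by (simp add: left_alternative m_closed)

lemma square_mult:
  assumes "x \<in> carrier Q" "y \<in> carrier Q"
  shows "(x \<otimes> y) \<otimes> (x \<otimes> y) = (x \<otimes> x) \<otimes> (y \<otimes> y)"
proof -
  have "(x \<otimes> y) \<otimes> (x \<otimes> y) = x \<otimes> ((y \<otimes> y) \<otimes> x)"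
    using rif_square[OF assms one_closed] assms by (simp add: r_one m_closed)
  also have "\<dots> = (x \<otimes> x) \<otimes> (y \<otimes> y)"
    using assms by (metis left_alternative m_closed m_comm)
  finally show ?thesis .
qed

text \<open>The product \<open>(u v)\<^sup>2 w\<^sup>2 u\<^sup>-\<^sup>1\<close> is evaluated in two ways.\<close>

lemma mult_square_aux:
  assumes u: "u \<in> carrier Q" and v: "v \<in> carrier Q" and w: "w \<in> carrier Q"
  shows "(u \<otimes> v) \<otimes> ((w \<otimes> w) \<otimes> v) = (v \<otimes> v) \<otimes> (u \<otimes> (w \<otimes> w))"
proof -
  let ?s = "u \<otimes> v"
  have s: "?s \<in> carrier Q" and ww: "w \<otimes> w \<in> carrier Q"
    using assms by (simp_all add: m_closed)
  have "?s \<otimes> ((w \<otimes> w) \<otimes> v) = ?s \<otimes> ((w \<otimes> w) \<otimes> (?s \<otimes> inv u))"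
    using u v by (metis m_comm inv_cancel_right)
  also have "\<dots> = ((?s \<otimes> w) \<otimes> (?s \<otimes> w)) \<otimes> inv u"
    using rif_square s w inv_closed[OF u] by simp
  also have "\<dots> = inv u \<otimes> ((?s \<otimes> ?s) \<otimes> (w \<otimes> w))"
    using s w inv_closed[OF u] by (simp add: square_mult m_comm m_closed)
  also have "\<dots> = inv u \<otimes> (u \<otimes> ((v \<otimes> v) \<otimes> (u \<otimes> (w \<otimes> w))))"
    using rif_square[OF u v ww] by simp
  also have "\<dots> = (v \<otimes> v) \<otimes> (u \<otimes> (w \<otimes> w))"
    using assms by (simp add: inv_cancel_left m_closed)
  finally show ?thesis .
qed

text \<open>\<open>mult_square_aux\<close> brings the left side into the form of a RIF expansion of
  \<open>(w \<otimes> (u \<otimes> v))\<^sup>2\<close> at \<open>inv u\<close>; the expansion with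
  \<open>w\<close> outermost yields the right side.\<close>

lemma square_mult_square:
  assumes u: "u \<in> carrier Q" and v: "v \<in> carrier Q" and w: "w \<in> carrier Q"
  shows "(v \<otimes> v) \<otimes> ((w \<otimes> w) \<otimes> u) = w \<otimes> (((v \<otimes> v) \<otimes> w) \<otimes> u)"
proof -
  let ?s = "u \<otimes> v"
  have s: "?s \<in> carrier Q" and ww: "w \<otimes> w \<in> carrier Q" and vv: "v \<otimes> v \<in> carrier Q"
    and iu: "inv u \<in> carrier Q"
    using assms by (simp_all add: m_closed inv_closed)
  have "(v \<otimes> v) \<otimes> ((w \<otimes> w) \<otimes> u) = ?s \<otimes> ((w \<otimes> w) \<otimes> v)"
    using mult_square_aux[OF assms] u ww by (simp add: m_comm)
  also have "\<dots> = ?s \<otimes> ((w \<otimes> w) \<otimes> (?s \<otimes> inv u))"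
    using u v by (metis m_comm inv_cancel_right)
  also have "\<dots> = ((w \<otimes> ?s) \<otimes> (w \<otimes> ?s)) \<otimes> inv u"
    using rif_square[OF s w iu] m_comm[OF s w] by simp
  also have "\<dots> = w \<otimes> ((?s \<otimes> ?s) \<otimes> (w \<otimes> inv u))"
    by (rule rif_square[OF w s iu])
  also have "\<dots> = w \<otimes> (u \<otimes> ((v \<otimes> v) \<otimes> (u \<otimes> (w \<otimes> inv u))))"
    using rif_square[OF u v] w iu by (simp add: m_closed)
  also have "u \<otimes> (w \<otimes> inv u) = w"
    using u w iu by (simp add: m_comm[OF w iu] cancel_inv_left)
  also have "w \<otimes> (u \<otimes> ((v \<otimes> v) \<otimes> w)) = w \<otimes> (((v \<otimes> v) \<otimes> w) \<otimes> u)"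
    using u vv w by (simp add: m_comm m_closed)
  finally show ?thesis .
qed

text \<open>Inverting the composed translations in \<open>square_mult_square\<close>, taken for
  \<open>inv v\<close> and \<open>inv w\<close>, reverses the order of the factors.\<close>

lemma square_mult_left:
  assumes v: "v \<in> carrier Q" and w: "w \<in> carrier Q" and z: "z \<in> carrier Q"
  shows "((v \<otimes> v) \<otimes> w) \<otimes> (w \<otimes> z) = (w \<otimes> w) \<otimes> ((v \<otimes> v) \<otimes> z)"
proof -
  let ?p = "(v \<otimes> v) \<otimes> w"
  have p: "?p \<in> carrier Q" and vv: "v \<otimes> v \<in> carrier Q" and ww: "w \<otimes> w \<in> carrier Q"
    and iv: "inv v \<in> carrier Q" and iw: "inv w \<in> carrier Q" and wz: "w \<otimes> z \<in> carrier Q"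
    using assms by (simp_all add: m_closed inv_closed)
  have pwz: "?p \<otimes> (w \<otimes> z) \<in> carrier Q"
    using p wz by (rule m_closed)
  have ivv: "inv v \<otimes> inv v = inv (v \<otimes> v)" and iww: "inv w \<otimes> inv w = inv (w \<otimes> w)"
    using v w by (simp_all add: inv_mult)
  have ip: "inv (v \<otimes> v) \<otimes> inv w = inv ?p"
    using vv w iw inv_closed[OF vv] by (simp add: inv_mult m_comm)
  have "inv (v \<otimes> v) \<otimes> (inv (w \<otimes> w) \<otimes> (?p \<otimes> (w \<otimes> z)))
      = inv w \<otimes> (inv ?p \<otimes> (?p \<otimes> (w \<otimes> z)))"
    using square_mult_square[OF pwz iv iw] by (simp only: ivv iww ip)
  also have "\<dots> = z"
    using p wz w z by (simp add: inv_cancel_left)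
  finally have "(v \<otimes> v) \<otimes> z = inv (w \<otimes> w) \<otimes> (?p \<otimes> (w \<otimes> z))"
    using cancel_inv_left[OF vv] m_closed inv_closed ww pwz by metis
  then show ?thesis
    using cancel_inv_left[OF ww pwz] by simp
qed

text \<open>Both sides equal
  \<open>(x \<otimes> x) \<otimes> ((y \<otimes> y) \<otimes> z)\<close>.\<close>

lemma arif:
  assumes "x \<in> carrier Q" "y \<in> carrier Q" "z \<in> carrier Q"
  shows "((y \<otimes> y) \<otimes> x) \<otimes> (x \<otimes> z) = y \<otimes> (((x \<otimes> x) \<otimes> y) \<otimes> z)"
  using square_mult_left[of y x z] square_mult_square[of z x y] assms by simp

section \<open>Moufang elements and their cubes\<close>

text \<open>The left Moufang identity at a fixed \<open>a\<close>, with
  \<open>a \<otimes> (x \<otimes> a)\<close> written as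
  \<open>(a \<otimes> a) \<otimes> x\<close>.\<close>

definition moufang_element :: "'a \<Rightarrow> bool" where
  "moufang_element a \<longleftrightarrow> a \<in> carrier Q \<and>
     (\<forall>x\<in>carrier Q. \<forall>y\<in>carrier Q. ((a \<otimes> a) \<otimes> x) \<otimes> y = a \<otimes> (x \<otimes> (a \<otimes> y)))"

lemma moufang_element_square:
  assumes b: "b \<in> carrier Q"
  shows "moufang_element (b \<otimes> b)"
proof -
  let ?a = "b \<otimes> b"
  have a: "?a \<in> carrier Q"
    using b by (simp add: m_closed)
  have "((?a \<otimes> ?a) \<otimes> x) \<otimes> y = ?a \<otimes> (x \<otimes> (?a \<otimes> y))"
    if x: "x \<in> carrier Q" and y: "y \<in> carrier Q" for x y
  proof -
    \<comment> \<open>Writing \<open>y\<close> as \<open>x \<otimes> (inv x \<otimes> y)\<close>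
      supplies the inner factor \<open>x\<close> required by both \<open>arif\<close> and
      RIF.\<close>
    have z: "inv x \<otimes> y \<in> carrier Q"
      using x y by (simp add: m_closed inv_closed)
    have xz: "x \<otimes> (inv x \<otimes> y) = y"
      using x y by (rule cancel_inv_left)
    have "((?a \<otimes> ?a) \<otimes> x) \<otimes> y = ?a \<otimes> (((x \<otimes> x) \<otimes> ?a) \<otimes> (inv x \<otimes> y))"
      using arif[OF x a z] by (simp only: xz)
    \<comment> \<open>Here it matters that \<open>?a\<close> is a square:
      \<open>(x \<otimes> x) \<otimes> ?a\<close> is the square of
      \<open>x \<otimes> b\<close>.\<close>
    also have "((x \<otimes> x) \<otimes> ?a) \<otimes> (inv x \<otimes> y) = x \<otimes> (?a \<otimes> y)"
      using rif_square[OF x b z] by (simp only: xz square_mult[OF x b])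
    finally show ?thesis .
  qed
  with a show ?thesis
    by (simp add: moufang_element_def)
qed

text \<open>Commutativity moves \<open>a\<close> to the front in each associativity law, which
  reduces membership to a single law.\<close>

lemma center_iff:
  "a \<in> loop_center Q \<longleftrightarrow> a \<in> carrier Q \<and>
     (\<forall>x\<in>carrier Q. \<forall>y\<in>carrier Q. a \<otimes> (x \<otimes> y) = (a \<otimes> x) \<otimes> y)"
  (is "_ \<longleftrightarrow> ?R")
proof
  show "a \<in> loop_center Q \<Longrightarrow> ?R"
    by (simp add: loop_center_def)
next
  assume R: ?R
  have "x \<otimes> (y \<otimes> a) = (x \<otimes> y) \<otimes> a" "x \<otimes> (a \<otimes> y) = (x \<otimes> a) \<otimes> y"
    if "x \<in> carrier Q" "y \<in> carrier Q" for x y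
    using R that by (metis m_closed m_comm)+
  with R show "a \<in> loop_center Q"
    by (auto simp: loop_center_def m_comm)
qed

text \<open>With \<open>a (u v) = (a\<^sup>2 u) (a\<^sup>-\<^sup>1 v)\<close>, which is the definition up to substitution, the inverse property
  gives \<open>a\<^sup>2 (u v) = (a u) (a v)\<close>; composing the two yields \<open>a\<^sup>3 (u v) = (a\<^sup>3 u) v\<close>.\<close>

lemma moufang_element_cube:
  assumes "moufang_element a"
  shows "a \<otimes> (a \<otimes> a) \<in> loop_center Q"
proof -
  have a: "a \<in> carrier Q"
    and M: "\<And>x y. \<lbrakk>x \<in> carrier Q; y \<in> carrier Q\<rbrakk> \<Longrightarrow> ((a \<otimes> a) \<otimes> x) \<otimes> y = a \<otimes> (x \<otimes> (a \<otimes> y))"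
    using assms by (auto simp: moufang_element_def)
  let ?b = "a \<otimes> a"
  have b: "?b \<in> carrier Q" and ia: "inv a \<in> carrier Q"
    using a by (simp_all add: m_closed inv_closed)
  have M1: "a \<otimes> (u \<otimes> v) = (?b \<otimes> u) \<otimes> (inv a \<otimes> v)"
    if "u \<in> carrier Q" "v \<in> carrier Q" for u v
    using M[of u "inv a \<otimes> v"] a ia that by (simp add: cancel_inv_left m_closed)
  have M2: "?b \<otimes> (u \<otimes> v) = (a \<otimes> u) \<otimes> (a \<otimes> v)"
    if u: "u \<in> carrier Q" and v: "v \<in> carrier Q" for u v
  proof -
    have iu: "inv u \<in> carrier Q" and uv: "u \<otimes> v \<in> carrier Q"
      and buv: "?b \<otimes> (u \<otimes> v) \<in> carrier Q"
      using u v b ia by (simp_all add: m_closed inv_closed)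
    have "a \<otimes> v = a \<otimes> ((u \<otimes> v) \<otimes> inv u)"
      using u v by (simp add: m_comm[OF u v] inv_cancel_right)
    also have "\<dots> = (?b \<otimes> (u \<otimes> v)) \<otimes> (inv a \<otimes> inv u)"
      by (rule M1[OF uv iu])
    also have "inv a \<otimes> inv u = inv (a \<otimes> u)"
      using a u ia iu by (simp add: inv_mult m_comm)
    finally have "a \<otimes> v = inv (a \<otimes> u) \<otimes> (?b \<otimes> (u \<otimes> v))"
      using a u buv by (simp add: m_comm[OF buv] inv_closed m_closed)
    then show ?thesis
      using cancel_inv_left[of "a \<otimes> u"] a u buv by (simp add: m_closed)
  qed
  have "(a \<otimes> ?b) \<otimes> (u \<otimes> v) = ((a \<otimes> ?b) \<otimes> u) \<otimes> v"
    if u: "u \<in> carrier Q" and v: "v \<in> carrier Q" for u v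
  proof -
    \<comment> \<open>The Moufang law with \<open>a\<close> itself as middle factor shows that
      translation by the cube is the third power of translation by \<open>a\<close>.\<close>
    have ab: "(a \<otimes> ?b) \<otimes> x = ?b \<otimes> (a \<otimes> x)" "a \<otimes> (?b \<otimes> x) = ?b \<otimes> (a \<otimes> x)"
      if x: "x \<in> carrier Q" for x
    proof -
      show "a \<otimes> (?b \<otimes> x) = ?b \<otimes> (a \<otimes> x)"
        using a x by (metis left_alternative m_closed)
      have "(a \<otimes> ?b) \<otimes> x = (?b \<otimes> a) \<otimes> x"
        using a b by (simp add: m_comm)
      also have "\<dots> = a \<otimes> (a \<otimes> (a \<otimes> x))"
        using M[OF a x] .
      also have "\<dots> = ?b \<otimes> (a \<otimes> x)"
        by (rule left_alternative[OF a m_closed[OF a x]])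
      finally show "(a \<otimes> ?b) \<otimes> x = ?b \<otimes> (a \<otimes> x)" .
    qed
    have "(a \<otimes> ?b) \<otimes> (u \<otimes> v) = ?b \<otimes> (a \<otimes> (u \<otimes> v))"
      using u v by (simp add: ab m_closed)
    also have "\<dots> = ?b \<otimes> ((?b \<otimes> u) \<otimes> (inv a \<otimes> v))"
      using M1[OF u v] by simp
    also have "\<dots> = (a \<otimes> (?b \<otimes> u)) \<otimes> (a \<otimes> (inv a \<otimes> v))"
      using b u ia v by (simp add: M2 m_closed)
    also have "\<dots> = ((a \<otimes> ?b) \<otimes> u) \<otimes> v"
      using a u v by (simp add: ab cancel_inv_left)
    finally show ?thesis .
  qed
  then show ?thesis
    using a b by (simp add: center_iff m_closed)
qed

lemma pow_closed: "x \<in> carrier Q \<Longrightarrow> x [^] (n::nat) \<in> carrier Q"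
  by (induction n) (simp_all add: nat_pow_def one_closed m_closed)

text \<open>The sixth power is the cube of the square, and squares are Moufang elements.\<close>

lemma pow6_in_center:
  assumes x: "x \<in> carrier Q"
  shows "x [^] (6::nat) \<in> loop_center Q"
proof -
  have pow_Suc: "x [^] Suc n = x \<otimes> x [^] n" for n :: nat
    using x pow_closed[OF x, of n] by (simp add: nat_pow_def m_comm)
  have "x [^] (6::nat) = x \<otimes> (x \<otimes> (x \<otimes> (x \<otimes> (x \<otimes> (x \<otimes> x [^] (0::nat))))))"
    by (simp only: numeral_eq_Suc pred_numeral_simps pow_Suc BitM.simps One_nat_def)
  also have "\<dots> = (x \<otimes> x) \<otimes> ((x \<otimes> x) \<otimes> (x \<otimes> x))"
    unfolding nat_pow_def by (simp, metis x left_alternative m_closed r_one)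
  also have "\<dots> \<in> loop_center Q"
    using x by (intro moufang_element_cube moufang_element_square)
  finally show ?thesis .
qed

section \<open>The center and the quotient by it\<close>

lemma center_carrier: "a \<in> loop_center Q \<Longrightarrow> a \<in> carrier Q"
  by (simp add: center_iff)

lemma center_assoc:
  "\<lbrakk>a \<in> loop_center Q; x \<in> carrier Q; y \<in> carrier Q\<rbrakk> \<Longrightarrow> (a \<otimes> x) \<otimes> y = a \<otimes> (x \<otimes> y)"
  by (simp add: center_iff)

lemma one_in_center: "\<one> \<in> loop_center Q"
  by (simp add: center_iff one_closed l_one m_closed)

lemma center_m_closed:
  assumes "a \<in> loop_center Q" "b \<in> loop_center Q"
  shows "a \<otimes> b \<in> loop_center Q"
  unfolding center_iff
  using assms by (simp add: center_carrier center_assoc m_closed)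

lemma center_inv_closed:
  assumes a: "a \<in> loop_center Q"
  shows "inv a \<in> loop_center Q"
  unfolding center_iff
proof (intro conjI ballI)
  have a': "a \<in> carrier Q" and ia: "inv a \<in> carrier Q"
    using a by (simp_all add: center_carrier inv_closed)
  then show "inv a \<in> carrier Q" by simp
  fix x y assume x: "x \<in> carrier Q" and y: "y \<in> carrier Q"
  have "a \<otimes> ((inv a \<otimes> x) \<otimes> y) = x \<otimes> y"
    using center_assoc[OF a, of "inv a \<otimes> x" y] a' ia x y
    by (simp add: cancel_inv_left m_closed)
  then show "inv a \<otimes> (x \<otimes> y) = (inv a \<otimes> x) \<otimes> y"
    using inv_cancel_left[OF a', of "(inv a \<otimes> x) \<otimes> y"] ia x y by (simp add: m_closed)
qed

text \<open>Central factors can be pulled out of both representatives, so products in the quotient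
  are computed on representatives.\<close>

lemma center_coset_mult:
  assumes x: "x \<in> carrier Q" and y: "y \<in> carrier Q"
  shows "(loop_center Q #> x) <#> (loop_center Q #> y) = loop_center Q #> (x \<otimes> y)"
proof -
  have swap: "(a \<otimes> x) \<otimes> (b \<otimes> y) = (a \<otimes> b) \<otimes> (x \<otimes> y)"
    if a: "a \<in> loop_center Q" and b: "b \<in> loop_center Q" for a b
  proof -
    have "x \<otimes> (b \<otimes> y) = b \<otimes> (x \<otimes> y)"
      using b x y center_assoc center_carrier m_comm m_closed by metis
    then show ?thesis
      using a b x y by (simp add: center_assoc center_carrier m_closed)
  qed
  show ?thesis
  proof
    show "(loop_center Q #> x) <#> (loop_center Q #> y) \<subseteq> loop_center Q #> (x \<otimes> y)"
      using swap center_m_closed by (fastforce simp: set_mult_def r_coset_def)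
    \<comment> \<open>For the converse inclusion the second central factor is taken to be
      \<open>\<one>\<close>.\<close>
    have "a \<otimes> (x \<otimes> y) = (a \<otimes> x) \<otimes> (\<one> \<otimes> y)" if "a \<in> loop_center Q" for a
      using that x y by (simp add: center_assoc l_one)
    then show "loop_center Q #> (x \<otimes> y) \<subseteq> (loop_center Q #> x) <#> (loop_center Q #> y)"
      using one_in_center by (fastforce simp: set_mult_def r_coset_def)
  qed
qed

text \<open>Central elements represent the neutral element of the quotient, which is the set
  \<open>loop_center Q\<close>.\<close>

lemma center_coset_self:
  assumes c: "c \<in> loop_center Q"
  shows "loop_center Q #> c = loop_center Q"
proof
  show "loop_center Q #> c \<subseteq> loop_center Q"
    using c center_m_closed by (auto simp: r_coset_def)
  show "loop_center Q \<subseteq> loop_center Q #> c"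
  proof
    fix a assume a: "a \<in> loop_center Q"
    have "a = (a \<otimes> inv c) \<otimes> c"
      using a c by (simp add: center_assoc center_carrier inv_closed l_inv r_one)
    then show "a \<in> loop_center Q #> c"
      using a c center_m_closed center_inv_closed by (auto simp: r_coset_def)
  qed
qed

text \<open>Both powers follow the same left-nested recursion, and \<open>center_coset_mult\<close>
  carries each step.\<close>

lemma pow_Mod_center:
  assumes x: "x \<in> carrier Q"
  shows "(loop_center Q #> x) [^]\<^bsub>Q Mod loop_center Q\<^esub> (n::nat) = loop_center Q #> (x [^] n)"
proof (induction n)
  case 0
  then show ?case
    by (simp add: nat_pow_def FactGroup_def center_coset_self one_in_center)
next
  case (Suc n)
  then show ?case
    using center_coset_mult[OF pow_closed[OF x, of n] x] by (simp add: nat_pow_def FactGroup_def)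
qed

end

theorem corollary4p4:
  fixes Q :: "('a, 'b) monoid_scheme"
  assumes "comm_rif_loop Q"
  shows "has_exponent (Q Mod loop_center Q) 6"
proof -
  interpret comm_rif_loop Q by fact
  \<comment> \<open>Every element of the quotient is a coset of this form, and the right side is its
    neutral element.\<close>
  have "(loop_center Q #>\<^bsub>Q\<^esub> x) [^]\<^bsub>Q Mod loop_center Q\<^esub> (6::nat) = loop_center Q"
    if "x \<in> carrier Q" for x
    using that by (simp add: pow_Mod_center center_coset_self pow6_in_center)
  then show ?thesis
    by (auto simp: has_exponent_def FactGroup_def RCOSETS_def)
qed

end
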